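(* Let $f$ be twice continuously differentiable, and suppose that $\nabla^2 f(\cdot)$ is $\alpha$-elliptic and $\gamma$-bounded for some $\alpha,\gamma>0$, i.e. $\alpha\|y\|_X^2\le\langle\nabla^2 f(x)y,y\rangle_X\le\gamma\|y\|_X^2$ for all $x,y\in X$. Suppose that $A:X\to Y$ is bounded from below with constant $\beta>0$, i.e. $\|Ax\|_Y^2\ge\beta\|x\|_X^2$ for all $x\in X$. Suppose moreover that $$2D_f(y,x)-\langle\nabla^2 f(x)(x-y),x-y\rangle_X\ge0\quad\text{for all }x,y\in X.$$ Set $$\rho=\begin{cases}\alpha/2,&\text{if }\gamma^2\le4\beta,\\ \min\{\alpha,\gamma-\sqrt{\gamma^2-4\beta}\}/2,&\text{if }\gamma^2>4\beta.\end{cases}$$ Let $(x,\lambda):[0,+\infty)\to X\times Y$ be a solution of the Arrow--Hurwicz differential system (AH). Then, for any $(\xi,\eta)\in S\times M$, the following assertions hold: (i) If $\rho^2-\gamma\rho+\beta>0$, then, as $t\to+\infty$, $$L(x(t),\eta)-L(\xi,\lambda(t))=\mathcal O(e^{-2\rho t}),\quad \|(\dot x(t),\dot\lambda(t))\|^2=\mathcal O(e^{-2\rho t}),\quad \|x(t)-\xi\|_X^2=\mathcal O(e^{-2\rho t}).$$ (ii) If $\rho^2-\gamma\rho+\beta=0$, then, as $t\to+\infty$, $$L(x(t),\eta)-L(\xi,\lambda(t))=\mathcal O(t^2e^{-2\rho t}),\quad \|(\dot x(t),\dot\lambda(t))\|^2=\mathcal O(t^2e^{-2\rho t}),\quad \|x(t)-\xi\|_X^2=\mathcal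 O(t^2e^{-2\rho t}).$$
   Context: $X$ and $Y$ are real Hilbert spaces with inner products $\langle\cdot,\cdot\rangle_X$, $\langle\cdot,\cdot\rangle_Y$ and norms $\|\cdot\|_X,\|\cdot\|_Y$; $X\times Y$ carries the product Hilbert structure, with norm $\|\cdot\|$. Standing assumptions: $f:X\to\mathbb R$ is convex and continuously differentiable; $\nabla f:X\to X$ is Lipschitz continuous on bounded sets; $A:X\to Y$ is linear and continuous with adjoint $A^*$; $b\in Y$; the set $S\times M$ defined below is non-empty. $\nabla^2 f$ denotes the Hessian of $f$, and $D_f$ the Bregman distance $D_f(y,x)=f(y)-f(x)-\langle\nabla f(x),y-x\rangle_X$. The Lagrangian is $L:X\times Y\to\mathbb R$, $L(x,\lambda)=f(x)+\langle\lambda,Ax-b\rangle_Y$. A saddle point of $L$ is a pair $(\bar x,\bar\lambda)\in X\times Y$ with $L(\bar x,\lambda)\le L(\bar x,\bar\lambda)\le L(x,\bar\lambda)$ for all $(x,\lambda)\in X\times Y$; the set of saddle points of $L$ is denoted by $S\times M\subset X\times Y$. The system (AH) is $$\dot x+\nabla f(x)+A^*\lambda=0_X,\qquad \dot\lambda+b-Ax=0_Y,$$ with initial data $(x(0),\lambda(0))=(x_0,\lambda_0)\in X\times Y$; a solution is a function $(x,\lambda)\in\mathcal C^1([0,+\infty);X\times Y)$ satisfying the system on $[0,+\infty)$ with these initial data. *)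

theory Defs
  imports "HOL-Analysis.Analysis" "HOL-Library.Landau_Symbols"
begin

text \<open>Real Hilbert spaces are the types of sort \<open>{real_inner, complete_space}\<close>;
  the product type carries the product Hilbert structure.\<close>

text \<open>Used only for \<open>S = UNIV\<close> and \<open>S = {0..}\<close>, where the derivative within \<open>S\<close> is unique
  (one-sided at the endpoint \<open>0\<close>). Continuity of the derivative is with respect to
  the operator norm.\<close>

definition continuously_differentiable_on ::
    "'a::real_normed_vector set \<Rightarrow> ('a \<Rightarrow> 'b::real_normed_vector) \<Rightarrow> bool" where
  "continuously_differentiable_on S f \<longleftrightarrow>
     (\<forall>x\<in>S. f differentiable (at x within S)) \<and>
     continuous_on S (\<lambda>x. Blinfun (frechet_derivative f (at x within S)))"

text \<open>On a Hilbert space the gradient of a differentiable function exists by the Riesz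
  representation theorem.\<close>

definition grad :: "('a::real_inner \<Rightarrow> real) \<Rightarrow> 'a \<Rightarrow> 'a" where
  "grad f x = (THE D. GDERIV f x :> D)"

definition hessian :: "('a::real_inner \<Rightarrow> real) \<Rightarrow> 'a \<Rightarrow> 'a \<Rightarrow> 'a" where
  "hessian f x = frechet_derivative (grad f) (at x)"

definition bregman :: "('a::real_inner \<Rightarrow> real) \<Rightarrow> 'a \<Rightarrow> 'a \<Rightarrow> real" where
  "bregman f y x = f y - f x - inner (grad f x) (y - x)"

definition lagrangian ::
    "('a::real_inner \<Rightarrow> real) \<Rightarrow> ('a \<Rightarrow> 'b::real_inner) \<Rightarrow> 'b \<Rightarrow> 'a \<Rightarrow> 'b \<Rightarrow> real" where
  "lagrangian f A b x l = f x + inner l (A x - b)"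

definition saddle_points ::
    "('a::real_inner \<Rightarrow> real) \<Rightarrow> ('a \<Rightarrow> 'b::real_inner) \<Rightarrow> 'b \<Rightarrow> ('a \<times> 'b) set" where
  "saddle_points f A b =
     {(x', l'). \<forall>x l. lagrangian f A b x' l \<le> lagrangian f A b x' l' \<and>
                      lagrangian f A b x' l' \<le> lagrangian f A b x l'}"

abbreviation time_deriv :: "(real \<Rightarrow> 'a::real_normed_vector) \<Rightarrow> real \<Rightarrow> 'a" where
  "time_deriv u t \<equiv> vector_derivative u (at t within {0..})"

definition AH_solution ::
    "('a::{real_inner,complete_space} \<Rightarrow> real) \<Rightarrow> ('a \<Rightarrow> 'b::{real_inner,complete_space}) \<Rightarrow> 'b \<Rightarrow>
     'a \<Rightarrow> 'b \<Rightarrow> (real \<Rightarrow> 'a) \<Rightarrow> (real \<Rightarrow> 'b) \<Rightarrow> bool" where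
  "AH_solution f A b x0 l0 x l \<longleftrightarrow>
     continuously_differentiable_on {0..} (\<lambda>t. (x t, l t)) \<and>
     (\<forall>t\<ge>0. time_deriv x t + grad f (x t) + adjoint A (l t) = 0 \<and>
            time_deriv l t + b - A (x t) = 0) \<and>
     x 0 = x0 \<and> l 0 = l0"

end

theory Submission
  imports Defs
begin

text \<open>Differentiating the first equation of (AH) and eliminating the multiplier shows that
  \<open>u = x - \<xi>\<close> solves the damped oscillator equation \<open>u'' + H u' + A\<^sup>* A u = 0\<close> with \<open>H\<close> the
  Hessian of \<open>f\<close> at \<open>x\<close>. Put \<open>p = u' + \<rho> u\<close> and let \<open>D\<close> be the Bregman distance of \<open>\<xi>\<close> from \<open>x\<close>,
  whose time derivative is \<open>\<langle>H u', u\<rangle>\<close>. Then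
  \<open>E = \<parallel>p\<parallel>\<^sup>2 + \<parallel>A u\<parallel>\<^sup>2 + \<rho>\<^sup>2 \<parallel>u\<parallel>\<^sup>2 - 2 \<rho> D\<close> satisfies
  \<open>E' + 2 \<rho> E = 4 \<rho> \<parallel>p\<parallel>\<^sup>2 - 2 \<langle>H p, p\<rangle> + 2 \<rho>\<^sup>2 (\<langle>H u, u\<rangle> - 2 D) \<le> 0\<close>, while
  \<open>2 D \<le> \<gamma> \<parallel>u\<parallel>\<^sup>2\<close> gives \<open>E \<ge> \<parallel>p\<parallel>\<^sup>2 + (\<rho>\<^sup>2 - \<gamma> \<rho> + \<beta>) \<parallel>u\<parallel>\<^sup>2\<close>. If the last coefficient is
  positive, both \<open>p\<close> and \<open>u\<close> decay like \<open>e\<close> to the power \<open>- \<rho> t\<close>; if it vanishes, the bound on \<open>p\<close>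
  says that the derivative of \<open>u\<close> times \<open>e\<close> to the power \<open>\<rho> t\<close> is bounded, which costs a factor \<open>t\<close>.\<close>

section \<open>Riesz representation, adjoints and gradients\<close>

text \<open>The representer minimises \<open>\<parallel>z\<parallel>\<^sup>2 / 2 - \<phi> z\<close>; the parallelogram law makes minimising
  sequences Cauchy.\<close>

lemma riesz_representation:
  fixes \<phi> :: "'a::{real_inner,complete_space} \<Rightarrow> real"
  assumes "bounded_linear \<phi>"
  shows "\<exists>z. \<forall>h. \<phi> h = inner h z"
proof -
  interpret bounded_linear \<phi> by fact
  obtain K where K: "K > 0" "\<And>h. norm (\<phi> h) \<le> norm h * K"
    using pos_bounded by blast
  define J where "J z = (norm z)\<^sup>2 / 2 - \<phi> z" for z
  have J_ge: "J z \<ge> - K\<^sup>2 / 2" for z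
  proof -
    have "\<phi> z \<le> norm z * K" using K(2)[of z] by simp
    moreover have "0 \<le> (norm z - K)\<^sup>2" by simp
    ultimately show ?thesis unfolding J_def by (simp add: power2_diff)
  qed
  define m where "m = (INF z. J z)"
  have bdd: "bdd_below (range J)" using J_ge by (meson bdd_belowI2)
  have m_le: "m \<le> J z" for z
    unfolding m_def by (rule cINF_lower[OF bdd]) simp
  have "\<exists>z. J z < m + 1 / real (Suc n)" for n
  proof (rule ccontr)
    assume "\<not> ?thesis"
    then have "m + 1 / real (Suc n) \<le> m"
      unfolding m_def by (intro cINF_greatest) (auto simp: not_less)
    then show False by simp
  qed
  then obtain z where z: "\<And>n. J (z n) < m + 1 / real (Suc n)" by metis
  \<comment> \<open>The linear part of \<open>J\<close> cancels against the midpoint, so only the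
    parallelogram defect of the norm remains; the value of \<open>J\<close> at the midpoint is at
    least \<open>m\<close>.\<close>
  have parallelogram: "(norm (a - c))\<^sup>2 \<le> 4 * (J a + J c - 2 * m)" for a c
  proof -
    have "\<phi> ((1/2) *\<^sub>R (a + c)) = (\<phi> a + \<phi> c) / 2"
      by (simp add: scaleR add)
    moreover have "(norm ((1/2) *\<^sub>R (a + c)))\<^sup>2 = (norm (a + c))\<^sup>2 / 4"
      by (simp add: power_divide)
    moreover have "(norm (a + c))\<^sup>2 + (norm (a - c))\<^sup>2 = 2 * (norm a)\<^sup>2 + 2 * (norm c)\<^sup>2"
      by (simp add: power2_norm_eq_inner algebra_simps)
    ultimately have "4 * (J a + J c) - 8 * J ((1/2) *\<^sub>R (a + c)) = (norm (a - c))\<^sup>2"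
      unfolding J_def by (simp add: field_simps)
    with m_le[of "(1/2) *\<^sub>R (a + c)"] show ?thesis by simp
  qed
  have "Cauchy z"
  proof (rule metric_CauchyI)
    fix e :: real assume e: "e > 0"
    \<comment> \<open>Two values within \<open>e\<^sup>2 / 8\<close> of \<open>m\<close> give
      \<open>4 * (e\<^sup>2 / 8 + e\<^sup>2 / 8) = e\<^sup>2\<close> in the parallelogram
      bound.\<close>
    obtain N where N: "1 / real (Suc N) < e\<^sup>2 / 8"
      using reals_Archimedean[of "e\<^sup>2 / 8"] e by (auto simp: inverse_eq_divide)
    have small: "J (z n) < m + e\<^sup>2 / 8" if "n \<ge> N" for n
    proof -
      have "1 / real (Suc n) \<le> 1 / real (Suc N)"
        using that by (simp add: frac_le)
      with z[of n] N show ?thesis by linarith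
    qed
    have "dist (z i) (z j) < e" if "i \<ge> N" "j \<ge> N" for i j
    proof -
      have "(norm (z i - z j))\<^sup>2 < e\<^sup>2"
        using parallelogram[of "z i" "z j"] small[OF that(1)] small[OF that(2)] by argo
      then show ?thesis unfolding dist_norm by (rule power_less_imp_less_base) (use e in simp)
    qed
    then show "\<exists>M. \<forall>i\<ge>M. \<forall>j\<ge>M. dist (z i) (z j) < e" by blast
  qed
  then obtain w where w: "z \<longlonglongrightarrow> w"
    using Cauchy_convergent convergent_def by blast
  have "(\<lambda>n. J (z n)) \<longlonglongrightarrow> J w"
    unfolding J_def by (intro tendsto_intros w tendsto) simp
  moreover have "(\<lambda>n. m + 1 / real (Suc n)) \<longlonglongrightarrow> m + 0"
    by (intro tendsto_add tendsto_const LIMSEQ_Suc lim_1_over_n)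
  ultimately have "J w \<le> m + 0"
    by (rule LIMSEQ_le) (use z less_imp_le in blast)
  then have w_min: "J w \<le> J y" for y using m_le[of y] by simp
  have "\<phi> h = inner h w" for h
  proof -
    define c where "c = inner h w - \<phi> h"
    define q where "q = (norm h)\<^sup>2"
    \<comment> \<open>Almost the minimiser \<open>- c / q\<close> of
      \<open>s * c + s\<^sup>2 * q / 2\<close>; the added 1 covers \<open>h = 0\<close> and still
      makes the value negative unless \<open>c = 0\<close>.\<close>
    define s where "s = - c / (q + 1)"
    have q: "q \<ge> 0" by (simp add: q_def)
    have "(norm (w + s *\<^sub>R h))\<^sup>2 = (norm w)\<^sup>2 + 2 * s * inner h w + s\<^sup>2 * q"
      by (simp add: q_def power2_norm_eq_inner inner_add_left inner_add_right inner_commute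
          power2_eq_square[of s])
    then have "J (w + s *\<^sub>R h) = J w + s * c + s\<^sup>2 * q / 2"
      unfolding J_def c_def by (simp add: add scaleR field_simps)
    with w_min[of "w + s *\<^sub>R h"] have "0 \<le> s * c + s\<^sup>2 * q / 2" by simp
    also have "\<dots> = - (s\<^sup>2 * (q + 2) / 2)"
    proof -
      have c: "c = - s * (q + 1)" using q by (simp add: s_def)
      show ?thesis unfolding c by (simp add: power2_eq_square field_simps)
    qed
    finally have "s\<^sup>2 * (q + 2) \<le> 0" by simp
    then have "s = 0" using q by (simp add: mult_le_0_iff)
    then have "c = 0" using q by (simp add: s_def)
    then show ?thesis by (simp add: c_def)
  qed
  then show ?thesis by blast
qed

text \<open>\<open>adjoint\<close> is a Hilbert choice, so a map for it to choose must exist: Riesz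
  applied to \<open>\<lambda>h. inner (A h) y\<close> for each \<open>y\<close> supplies
  one.\<close>

lemma inner_adjoint:
  fixes A :: "'a::{real_inner,complete_space} \<Rightarrow> 'b::real_inner"
  assumes "bounded_linear A"
  shows "inner (A u) y = inner u (adjoint A y)"
proof -
  have "\<exists>z. \<forall>h. inner (A h) y = inner h z" for y
    by (rule riesz_representation)
       (rule bounded_linear_compose[OF bounded_linear_inner_left assms])
  then have "\<exists>A'. \<forall>u y. inner (A u) y = inner u (A' y)" by metis
  then have "\<forall>u y. inner (A u) y = inner u (adjoint A y)"
    unfolding adjoint_def by (rule someI_ex)
  then show ?thesis by blast
qed

text \<open>Linearity follows by testing against all vectors; for the bound, \<open>y\<close> is
  paired with \<open>A (adjoint A y)\<close> and one factor \<open>norm (adjoint A y)\<close> is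
  cancelled. This allows \<open>adjoint A (l t)\<close> to be differentiated in time.\<close>

lemma bounded_linear_adjoint:
  fixes A :: "'a::{real_inner,complete_space} \<Rightarrow> 'b::real_inner"
  assumes "bounded_linear A"
  shows "bounded_linear (adjoint A)"
proof -
  note adj = inner_adjoint[OF assms]
  obtain K where K: "K \<ge> 0" "\<And>u. norm (A u) \<le> norm u * K"
    using assms bounded_linear.nonneg_bounded by blast
  show ?thesis
  proof (rule bounded_linear_intro[where K = K])
    fix y z :: 'b and r :: real
    show "adjoint A (y + z) = adjoint A y + adjoint A z"
      by (rule vector_eq_rdot[THEN iffD1]) (metis adj inner_commute inner_add_left)
    show "adjoint A (r *\<^sub>R y) = r *\<^sub>R adjoint A y"
      by (rule vector_eq_rdot[THEN iffD1]) (metis adj inner_commute inner_scaleR_left)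
    show "norm (adjoint A y) \<le> norm y * K"
    proof (cases "adjoint A y = 0")
      case True
      then show ?thesis using K(1) by simp
    next
      case False
      have "(norm (adjoint A y))\<^sup>2 = inner (A (adjoint A y)) y"
        by (simp add: adj power2_norm_eq_inner)
      also have "\<dots> \<le> norm (A (adjoint A y)) * norm y" by (rule norm_cauchy_schwarz)
      also have "\<dots> \<le> norm (adjoint A y) * K * norm y" by (intro mult_right_mono K) simp
      finally show ?thesis using False by (simp add: power2_eq_square mult.assoc mult.commute)
    qed
  qed
qed

lemma gderiv_unique:
  assumes "GDERIV f x :> D" "GDERIV f x :> E"
  shows "D = E"
proof -
  have "(\<lambda>h. inner h D) = (\<lambda>h. inner h E)"
    using assms unfolding gderiv_def by (rule has_derivative_unique)
  then show ?thesis by (metis vector_eq_ldot)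
qed

text \<open>Gives the description operator in \<open>grad\<close> its meaning: Riesz supplies a
  gradient and \<open>gderiv_unique\<close> makes it the only one.\<close>

lemma GDERIV_grad:
  fixes f :: "'a::{real_inner,complete_space} \<Rightarrow> real"
  assumes "f differentiable (at x)"
  shows "GDERIV f x :> grad f x"
proof -
  obtain f' where f': "(f has_derivative f') (at x)"
    using assms by (auto simp: differentiable_def)
  then obtain D where "f' = (\<lambda>h. inner h D)"
    using riesz_representation[OF has_derivative_bounded_linear] by blast
  with f' have "GDERIV f x :> D" unfolding gderiv_def by simp
  then show ?thesis unfolding grad_def by (metis gderiv_unique theI)
qed

lemma GDERIV_along_line:
  assumes "GDERIV f (a + r *\<^sub>R u) :> D"
  shows "((\<lambda>r. f (a + r *\<^sub>R u)) has_real_derivative inner D u) (at r)"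
proof -
  have "((\<lambda>r. a + r *\<^sub>R u) has_derivative (\<lambda>h. h *\<^sub>R u)) (at r)"
    by (auto intro!: derivative_eq_intros)
  from has_derivative_compose[OF this assms[unfolded gderiv_def]]
  show ?thesis by (simp add: has_field_derivative_def inner_commute mult_commute_abs)
qed

section \<open>Symmetry of the Hessian\<close>

text \<open>The mean value theorem in direction \<open>u\<close> leaves a difference of two values
  of \<open>g\<close> near \<open>x\<close>; linearising both at \<open>x\<close> itself leaves an
  error controlled by \<open>\<epsilon>\<close> alone.\<close>

lemma second_difference_quotient:
  fixes f :: "'a::real_inner \<Rightarrow> real"
  assumes f: "\<And>x. GDERIV f x :> g x"
    and g: "\<And>h. norm h < \<delta> \<Longrightarrow> norm (g (x + h) - g x - H h) \<le> \<epsilon> * norm h"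
    and H: "linear H" and s: "s > 0" "s * (norm u + norm v) < \<delta>" and \<epsilon>: "\<epsilon> \<ge> 0"
  shows "\<bar>f (x + s *\<^sub>R u + s *\<^sub>R v) - f (x + s *\<^sub>R u) - f (x + s *\<^sub>R v) + f x - s\<^sup>2 * inner (H v) u\<bar>
           \<le> s\<^sup>2 * (2 * \<epsilon> * (norm u + norm v)\<^sup>2)"
proof -
  let ?M = "norm u + norm v"
  \<comment> \<open>The increment in \<open>v\<close> is frozen and \<open>r\<close> runs in
    direction \<open>u\<close>, so \<open>?\<psi> s - ?\<psi> 0\<close> is the second
    difference.\<close>
  let ?\<psi> = "\<lambda>r. f ((x + s *\<^sub>R v) + r *\<^sub>R u) - f (x + r *\<^sub>R u)"
  have "\<exists>\<theta>. \<theta> > 0 \<and> \<theta> < s \<and>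
      ?\<psi> s - ?\<psi> 0 = (s - 0) * (inner (g ((x + s *\<^sub>R v) + \<theta> *\<^sub>R u)) u - inner (g (x + \<theta> *\<^sub>R u)) u)"
    by (rule MVT2[OF s(1)]) (intro DERIV_diff GDERIV_along_line f)
  then obtain \<theta> where \<theta>: "0 < \<theta>" "\<theta> < s" and
    mv: "?\<psi> s - ?\<psi> 0 = s * (inner (g ((x + s *\<^sub>R v) + \<theta> *\<^sub>R u)) u - inner (g (x + \<theta> *\<^sub>R u)) u)"
    by auto
  define h1 where "h1 = s *\<^sub>R v + \<theta> *\<^sub>R u"
  define h2 where "h2 = \<theta> *\<^sub>R u"
  \<comment> \<open>Both remainders are taken at \<open>x\<close>; the \<open>\<theta>\<close> parts
    of \<open>H h1\<close> and \<open>H h2\<close> cancel and leave exactly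
    \<open>s *\<^sub>R H v\<close>.\<close>
  define e1 where "e1 = g (x + h1) - g x - H h1"
  define e2 where "e2 = g (x + h2) - g x - H h2"
  have "\<theta> * norm u \<le> s * norm u" using \<theta> by (intro mult_right_mono) auto
  moreover have "norm h1 \<le> s * norm v + \<theta> * norm u"
    unfolding h1_def using norm_triangle_ineq[of "s *\<^sub>R v" "\<theta> *\<^sub>R u"] s \<theta> by simp
  moreover have "norm h2 = \<theta> * norm u" using \<theta> by (simp add: h2_def)
  moreover have "s * norm v \<ge> 0" using s by simp
  ultimately have h: "norm h1 \<le> s * ?M" "norm h2 \<le> s * ?M"
    by (simp_all add: distrib_left)
  have e: "norm e1 \<le> \<epsilon> * (s * ?M)" "norm e2 \<le> \<epsilon> * (s * ?M)"
    unfolding e1_def e2_def using g[of h1] g[of h2] h s(2) mult_left_mono[OF h(1) \<epsilon>] mult_left_mono[OF h(2) \<epsilon>]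
    by linarith+
  have "H h1 = s *\<^sub>R H v + H h2"
    unfolding h1_def h2_def by (simp add: linear_add[OF H] linear_scale[OF H])
  then have diff: "g (x + h1) - g (x + h2) = s *\<^sub>R H v + (e1 - e2)"
    unfolding e1_def e2_def by simp
  have "f (x + s *\<^sub>R u + s *\<^sub>R v) - f (x + s *\<^sub>R u) - f (x + s *\<^sub>R v) + f x = ?\<psi> s - ?\<psi> 0"
    by (simp add: algebra_simps)
  also have "\<dots> = s * inner (g (x + h1) - g (x + h2)) u"
    unfolding mv h1_def h2_def by (simp add: algebra_simps)
  also have "\<dots> = s\<^sup>2 * inner (H v) u + s * inner (e1 - e2) u"
    unfolding diff by (simp add: inner_add_left power2_eq_square algebra_simps)
  finally have eq: "f (x + s *\<^sub>R u + s *\<^sub>R v) - f (x + s *\<^sub>R u) - f (x + s *\<^sub>R v) + f x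
      - s\<^sup>2 * inner (H v) u = s * inner (e1 - e2) u" by simp
  have "\<bar>inner (e1 - e2) u\<bar> \<le> norm (e1 - e2) * norm u" by (rule Cauchy_Schwarz_ineq2)
  also have "\<dots> \<le> (2 * \<epsilon> * (s * ?M)) * ?M"
    using norm_triangle_ineq4[of e1 e2] e \<epsilon> s by (intro mult_mono) auto
  finally have "s * \<bar>inner (e1 - e2) u\<bar> \<le> s * ((2 * \<epsilon> * (s * ?M)) * ?M)"
    using s by (intro mult_left_mono) auto
  moreover have "\<bar>s * inner (e1 - e2) u\<bar> = s * \<bar>inner (e1 - e2) u\<bar>"
    using s by (simp add: abs_mult)
  ultimately show ?thesis unfolding eq by (simp add: power2_eq_square mult_ac)
qed

text \<open>The second difference of \<open>f\<close> is symmetric in the two increments \<open>u\<close> and \<open>v\<close>.\<close>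

lemma gradient_derivative_symmetric:
  fixes f :: "'a::real_inner \<Rightarrow> real"
  assumes f: "\<And>x. GDERIV f x :> g x" and g: "(g has_derivative H) (at x)"
  shows "inner (H u) v = inner (H v) u"
proof (rule ccontr)
  assume ne: "inner (H u) v \<noteq> inner (H v) u"
  define M where "M = norm u + norm v"
  have lin: "linear H" using g by (simp add: has_derivative_linear)
  have M: "M > 0"
    using ne unfolding M_def by (auto simp: add_nonneg_eq_0_iff less_le)
  \<comment> \<open>Relative to \<open>s\<^sup>2\<close>, each order of the increments is off by at
    most \<open>2 * \<epsilon> * M\<^sup>2\<close>; the factor 8 makes the total error half of the
    supposed asymmetry.\<close>
  define \<epsilon> where "\<epsilon> = \<bar>inner (H u) v - inner (H v) u\<bar> / (8 * M\<^sup>2)"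
  have \<epsilon>: "\<epsilon> > 0" using ne M by (simp add: \<epsilon>_def)
  obtain \<delta> where \<delta>: "\<delta> > 0"
    "\<And>y. norm (y - x) < \<delta> \<Longrightarrow> norm (g y - g x - H (y - x)) \<le> \<epsilon> * norm (y - x)"
    using g \<epsilon> unfolding has_derivative_at_alt by blast
  have \<delta>': "norm (g (x + h) - g x - H h) \<le> \<epsilon> * norm h" if "norm h < \<delta>" for h
    using \<delta>(2)[of "x + h"] that by simp
  define s where "s = \<delta> / (2 * M)"
  have s: "s > 0" "s * M < \<delta>" using \<delta>(1) M by (auto simp: s_def)
  have q: "\<bar>f (x + s *\<^sub>R u + s *\<^sub>R v) - f (x + s *\<^sub>R u) - f (x + s *\<^sub>R v) + f x - s\<^sup>2 * inner (H v) u\<bar>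
           \<le> s\<^sup>2 * (2 * \<epsilon> * M\<^sup>2)"
    using second_difference_quotient[OF f \<delta>' lin s(1) _ less_imp_le[OF \<epsilon>], where u = u and v = v] s(2)
    unfolding M_def by blast
  have q': "\<bar>f (x + s *\<^sub>R v + s *\<^sub>R u) - f (x + s *\<^sub>R v) - f (x + s *\<^sub>R u) + f x - s\<^sup>2 * inner (H u) v\<bar>
           \<le> s\<^sup>2 * (2 * \<epsilon> * M\<^sup>2)"
    using second_difference_quotient[OF f \<delta>' lin s(1) _ less_imp_le[OF \<epsilon>], where u = v and v = u] s(2)
    unfolding M_def by (metis add.commute)
  have comm: "x + s *\<^sub>R v + s *\<^sub>R u = x + s *\<^sub>R u + s *\<^sub>R v" by simp
  have "\<bar>s\<^sup>2 * inner (H u) v - s\<^sup>2 * inner (H v) u\<bar> \<le> 2 * (s\<^sup>2 * (2 * \<epsilon> * M\<^sup>2))"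
    using q q' unfolding comm by linarith
  also have "\<dots> = s\<^sup>2 * (\<bar>inner (H u) v - inner (H v) u\<bar> / 2)"
    using M by (simp add: \<epsilon>_def field_simps)
  finally have "s\<^sup>2 * \<bar>inner (H u) v - inner (H v) u\<bar> \<le> s\<^sup>2 * (\<bar>inner (H u) v - inner (H v) u\<bar> / 2)"
    by (simp add: right_diff_distrib[symmetric] abs_mult)
  then show False using s(1) ne by simp
qed

section \<open>Quadratic bounds on the Bregman distance\<close>

text \<open>Along the line through \<open>x\<close> and \<open>y\<close>, subtracting
  \<open>c / 2\<close> times the squared distance from \<open>f\<close> leaves a second derivative
  that is nonnegative for \<open>c = \<alpha>\<close> and nonpositive for
  \<open>c = \<gamma>\<close>; two monotonicity arguments carry the sign down to the
  function.\<close>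

lemma bregman_bounds:
  fixes f :: "'a::real_inner \<Rightarrow> real"
  assumes f: "\<And>x. GDERIV f x :> grad f x" and g: "\<And>x. (grad f has_derivative hessian f x) (at x)"
    and lower: "\<And>u y. \<alpha> * (norm y)\<^sup>2 \<le> inner (hessian f u y) y"
    and upper: "\<And>u y. inner (hessian f u y) y \<le> \<gamma> * (norm y)\<^sup>2"
  shows "\<alpha> / 2 * (norm (y - x))\<^sup>2 \<le> bregman f y x" "bregman f y x \<le> \<gamma> / 2 * (norm (y - x))\<^sup>2"
proof -
  define w where "w = y - x"
  have d2: "((\<lambda>r. inner (grad f (x + r *\<^sub>R w)) w) has_real_derivative
      inner (hessian f (x + r *\<^sub>R w) w) w) (at r)" for r
  proof -
    interpret bounded_linear "hessian f (x + r *\<^sub>R w)"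
      using g by (rule has_derivative_bounded_linear)
    have "((\<lambda>r. x + r *\<^sub>R w) has_derivative (\<lambda>h. h *\<^sub>R w)) (at r)"
      by (auto intro!: derivative_eq_intros)
    from has_derivative_inner_left[OF has_derivative_compose[OF this g], of w]
    show ?thesis by (simp add: has_field_derivative_def scaleR mult.commute[of _ "inner _ _"])
  qed
  \<comment> \<open>\<open>\<psi> c 0\<close> is \<open>f x\<close>, and \<open>\<psi> c 1\<close>
    differs from it by \<open>bregman f y x - c / 2 * (norm w)\<^sup>2\<close>.\<close>
  define \<psi> where "\<psi> c r = f (x + r *\<^sub>R w) - r * inner (grad f x) w - c / 2 * r\<^sup>2 * (norm w)\<^sup>2" for c r
  have d1: "(\<psi> c has_real_derivative
      inner (grad f (x + r *\<^sub>R w)) w - inner (grad f x) w - c * r * (norm w)\<^sup>2) (at r)" for c r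
    unfolding \<psi>_def by (auto intro!: derivative_eq_intros GDERIV_along_line f)
  let ?G = "\<lambda>c r. inner (grad f (x + r *\<^sub>R w)) w - inner (grad f x) w - c * r * (norm w)\<^sup>2"
  have d1': "(?G c
      has_real_derivative inner (hessian f (x + r *\<^sub>R w) w) w - c * (norm w)\<^sup>2) (at r)" for c r
    by (auto intro!: derivative_eq_intros d2)
  have low: "0 \<le> inner (grad f (x + r *\<^sub>R w)) w - inner (grad f x) w - \<alpha> * r * (norm w)\<^sup>2" if "0 \<le> r" for r
  proof -
    have "?G \<alpha> 0 \<le> ?G \<alpha> r"
      by (rule DERIV_nonneg_imp_nondecreasing[OF that]) (use d1' lower[of w] in fastforce)
    then show ?thesis by simp
  qed
  have up: "inner (grad f (x + r *\<^sub>R w)) w - inner (grad f x) w - \<gamma> * r * (norm w)\<^sup>2 \<le> 0" if "0 \<le> r" for r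
  proof -
    have "?G \<gamma> 0 \<ge> ?G \<gamma> r"
      by (rule DERIV_nonpos_imp_nonincreasing[OF that]) (use d1' upper[of _ w] in fastforce)
    then show ?thesis by simp
  qed
  have "\<psi> \<alpha> 0 \<le> \<psi> \<alpha> 1"
    by (rule DERIV_nonneg_imp_nondecreasing) (use d1 low in force)+
  then show "\<alpha> / 2 * (norm (y - x))\<^sup>2 \<le> bregman f y x"
    by (simp add: \<psi>_def w_def bregman_def)
  have "\<psi> \<gamma> 1 \<le> \<psi> \<gamma> 0"
    by (rule DERIV_nonpos_imp_nonincreasing) (use d1 up in force)+
  then show "bregman f y x \<le> \<gamma> / 2 * (norm (y - x))\<^sup>2"
    by (simp add: \<psi>_def w_def bregman_def)
qed

section \<open>Differential inequalities and exponential decay\<close>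

lemma has_real_derivative_norm_power2:
  fixes p :: "real \<Rightarrow> 'a::real_inner"
  assumes "(p has_vector_derivative p') (at t within S)"
  shows "((\<lambda>t. (norm (p t))\<^sup>2) has_real_derivative 2 * inner (p t) p') (at t within S)"
proof -
  have p: "(p has_derivative (\<lambda>h. h *\<^sub>R p')) (at t within S)"
    using assms by (simp add: has_vector_derivative_def)
  have "((\<lambda>t. inner (p t) (p t)) has_derivative (\<lambda>h. inner (p t) (h *\<^sub>R p') + inner (h *\<^sub>R p') (p t)))
      (at t within S)"
    by (rule has_derivative_inner[OF p p])
  moreover have "(\<lambda>h. inner (p t) (h *\<^sub>R p') + inner (h *\<^sub>R p') (p t)) = (*) (2 * inner (p t) p')"
    by (auto simp: inner_commute algebra_simps)
  ultimately show ?thesis by (simp add: has_field_derivative_def power2_norm_eq_inner)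
qed

text \<open>The product \<open>exp (c * t) * E t\<close> has nonpositive derivative, hence stays
  below its initial value.\<close>

lemma gronwall_exponential_decay:
  fixes E :: "real \<Rightarrow> real"
  assumes E: "\<And>t. t \<ge> 0 \<Longrightarrow> (E has_real_derivative E' t) (at t within {0..})"
    and le: "\<And>t. t \<ge> 0 \<Longrightarrow> E' t \<le> - c * E t" and "t \<ge> 0"
  shows "E t \<le> E 0 * exp (- c * t)"
proof -
  let ?F = "\<lambda>t. exp (c * t) * E t"
  have F: "(?F has_real_derivative exp (c * s) * (E' s + c * E s)) (at s within {0..})" if "s \<ge> 0" for s
    by (auto intro!: derivative_eq_intros E that simp: algebra_simps)
  have "?F t \<le> ?F 0"
  \<comment> \<open>Two-sided derivatives are required only inside the interval; at 0, where the
    derivative is one-sided, continuity suffices.\<close>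
  proof (rule DERIV_nonpos_imp_decreasing_open[OF \<open>t \<ge> 0\<close>])
    fix s assume s: "0 < s" "s < t"
    have "at s within {0..} = at s"
      by (rule at_within_interior) (use s in \<open>simp add: interior_Ici[of "-1"]\<close>)
    moreover have "exp (c * s) * (E' s + c * E s) \<le> 0"
      using le[of s] s by (simp add: mult_le_0_iff)
    ultimately show "\<exists>y. (?F has_real_derivative y) (at s) \<and> y \<le> 0"
      using F[of s] s by force
    next
    have "continuous_on {0..} ?F"
      unfolding continuous_on_eq_continuous_within using F DERIV_continuous by fastforce
    then show "continuous_on {0..t} ?F" by (rule continuous_on_subset) auto
  qed
  then have "exp (c * t) * E t \<le> E 0" by simp
  then show ?thesis by (simp add: exp_minus field_simps)
qed

text \<open>The derivative of \<open>exp (\<rho> * t) *\<^sub>R u t\<close> is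
  \<open>v t + \<rho> *\<^sub>R u t\<close> scaled by \<open>exp (\<rho> * t)\<close>, so its norm
  is at most \<open>C\<close>, and the mean value inequality allows at most linear growth.\<close>

lemma linear_growth_exponential_decay:
  fixes u v :: "real \<Rightarrow> 'a::real_normed_vector"
  assumes u: "\<And>t. t \<ge> 0 \<Longrightarrow> (u has_vector_derivative v t) (at t within {0..})"
    and le: "\<And>t. t \<ge> 0 \<Longrightarrow> norm (v t + \<rho> *\<^sub>R u t) \<le> C * exp (- \<rho> * t)" and t: "t \<ge> 0"
  shows "norm (u t) \<le> (norm (u 0) + C * t) * exp (- \<rho> * t)"
proof -
  let ?w = "\<lambda>t. exp (\<rho> * t) *\<^sub>R u t"
  have w: "(?w has_derivative (\<lambda>h. h *\<^sub>R exp (\<rho> * s) *\<^sub>R (v s + \<rho> *\<^sub>R u s))) (at s within {0..})"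
    if "s \<ge> 0" for s
  proof -
    have "(?w has_vector_derivative exp (\<rho> * s) *\<^sub>R v s + (exp (\<rho> * s) * \<rho>) *\<^sub>R u s) (at s within {0..})"
      by (rule has_vector_derivative_scaleR[OF _ u[OF that]]) (auto intro!: derivative_eq_intros)
    then show ?thesis by (simp add: has_vector_derivative_def scaleR_add_right)
  qed
  have "norm (?w t - ?w 0) \<le> C * norm (t - 0)"
  proof (rule differentiable_bound[OF _ w])
    fix s :: real assume "s \<in> {0..}"
    then have "exp (\<rho> * s) * norm (v s + \<rho> *\<^sub>R u s) \<le> exp (\<rho> * s) * (C * exp (- \<rho> * s))"
      by (intro mult_left_mono le) auto
    also have "\<dots> = C" by (simp add: exp_minus)
    finally have "exp (\<rho> * s) * norm (v s + \<rho> *\<^sub>R u s) \<le> C" .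
    then show "onorm (\<lambda>h. h *\<^sub>R exp (\<rho> * s) *\<^sub>R (v s + \<rho> *\<^sub>R u s)) \<le> C"
      by (intro onorm_le) (simp add: abs_mult mult.assoc mult.commute[of C] mult_left_mono)
  qed (use t in auto)
  then have "exp (\<rho> * t) * norm (u t) \<le> norm (u 0) + C * t"
    using norm_triangle_ineq2[of "?w t" "?w 0"] t by simp
  then show ?thesis by (simp add: exp_minus field_simps)
qed

section \<open>The energy estimate\<close>

text \<open>\<open>H\<close> stands for the Hessian along the trajectory and \<open>D\<close> for
  the Bregman distance; the abstract form separates the energy argument from \<open>f\<close>. No
  sign is asked of the coefficient of \<open>(norm (u t))\<^sup>2\<close>, so one estimate serves
  both regimes.\<close>

lemma damped_oscillator_decay:
  fixes u v :: "real \<Rightarrow> 'a::real_inner" and A :: "'a \<Rightarrow> 'b::real_inner"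
    and H :: "real \<Rightarrow> 'a \<Rightarrow> 'a" and D :: "real \<Rightarrow> real"
  assumes u: "\<And>t. t \<ge> 0 \<Longrightarrow> (u has_vector_derivative v t) (at t within {0..})"
    and v: "\<And>t. t \<ge> 0 \<Longrightarrow> (v has_vector_derivative - H t (v t) - A' (A (u t))) (at t within {0..})"
    and D: "\<And>t. t \<ge> 0 \<Longrightarrow> (D has_real_derivative inner (H t (v t)) (u t)) (at t within {0..})"
    and A: "bounded_linear A" "\<And>y z. inner (A y) z = inner y (A' z)" "\<And>y. \<beta> * (norm y)\<^sup>2 \<le> (norm (A y))\<^sup>2"
    and H: "\<And>t. linear (H t)" "\<And>t y z. inner (H t y) z = inner (H t z) y"
      "\<And>t y. \<alpha> * (norm y)\<^sup>2 \<le> inner (H t y) y"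
    and D_lower: "\<And>t. inner (H t (u t)) (u t) \<le> 2 * D t"
    and D_upper: "\<And>t. D t \<le> \<gamma> / 2 * (norm (u t))\<^sup>2"
    and \<rho>: "0 \<le> \<rho>" "2 * \<rho> \<le> \<alpha>"
  shows "\<exists>C. \<forall>t\<ge>0.
    (norm (v t + \<rho> *\<^sub>R u t))\<^sup>2 + (\<rho>\<^sup>2 - \<gamma> * \<rho> + \<beta>) * (norm (u t))\<^sup>2 \<le> C * exp (- (2 * \<rho>) * t)"
proof -
  define p where "p t = v t + \<rho> *\<^sub>R u t" for t
  define E where "E t = (norm (p t))\<^sup>2 + (norm (A (u t)))\<^sup>2 + \<rho>\<^sup>2 * (norm (u t))\<^sup>2 - 2 * \<rho> * D t" for t
  define E' where "E' t = 2 * inner (p t) (- H t (v t) - A' (A (u t)) + \<rho> *\<^sub>R v t)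
    + 2 * inner (A (u t)) (A (v t)) + \<rho>\<^sup>2 * (2 * inner (u t) (v t)) - 2 * \<rho> * inner (H t (v t)) (u t)" for t
  have deriv: "(E has_real_derivative E' t) (at t within {0..})" if "t \<ge> 0" for t
  proof -
    have "(p has_vector_derivative - H t (v t) - A' (A (u t)) + \<rho> *\<^sub>R v t) (at t within {0..})"
      unfolding p_def using u[OF that] v[OF that]
      by (intro has_vector_derivative_add) (auto intro!: bounded_linear.has_vector_derivative[OF bounded_linear_scaleR_right])
    moreover have "((\<lambda>t. A (u t)) has_vector_derivative A (v t)) (at t within {0..})"
      by (rule bounded_linear.has_vector_derivative[OF A(1) u[OF that]])
    ultimately show ?thesis
      unfolding E_def E'_def
      by (intro DERIV_diff DERIV_add DERIV_cmult has_real_derivative_norm_power2 u D that)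
  qed
  have "E' t \<le> - (2 * \<rho>) * E t" for t
  proof -
    have v_eq: "v t = p t - \<rho> *\<^sub>R u t" by (simp add: p_def)
    have Hv: "H t (v t) = H t (p t) - \<rho> *\<^sub>R H t (u t)"
      unfolding v_eq by (simp add: linear_diff[OF H(1)] linear_scale[OF H(1)])
    have Av: "inner (A (u t)) (A (v t)) = inner (p t) (A' (A (u t))) - \<rho> * (norm (A (u t)))\<^sup>2"
    proof -
      have "inner (A (u t)) (A (v t)) = inner (A (v t)) (A (u t))" by (rule inner_commute)
      also have "\<dots> = inner (A (p t)) (A (u t)) - \<rho> * inner (A (u t)) (A (u t))"
        unfolding v_eq using A(1) by (simp add: linear_diff linear_scale bounded_linear.linear inner_diff_left)
      finally show ?thesis by (simp add: A(2) power2_norm_eq_inner)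
    qed
    \<comment> \<open>After \<open>v\<close> is replaced by \<open>p - \<rho> u\<close>, the
      \<open>A'\<close> terms cancel through \<open>Av\<close>, and the mixed terms of
      \<open>H\<close> in \<open>p\<close> and \<open>u\<close> cancel by its symmetry
      \<open>H(2)\<close>.\<close>
    have "E' t + 2 * \<rho> * E t = 4 * \<rho> * (norm (p t))\<^sup>2 - 2 * inner (H t (p t)) (p t)
        + 2 * \<rho>\<^sup>2 * (inner (H t (u t)) (u t) - 2 * D t)"
      unfolding E'_def E_def Av Hv unfolding v_eq
      using H(2)[of t "p t" "u t"]
      by (simp add: inner_diff_left inner_diff_right inner_add_right power2_norm_eq_inner
          inner_commute algebra_simps power2_eq_square[of \<rho>])
    also have "\<dots> \<le> 0"
    proof -
      \<comment> \<open>Here \<open>2 * \<rho> \<le> \<alpha>\<close> enters: ellipticity absorbs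
        the term \<open>4 * \<rho> * (norm (p t))\<^sup>2\<close>.\<close>
      have "2 * \<rho> * (norm (p t))\<^sup>2 \<le> inner (H t (p t)) (p t)"
        using H(3)[of "p t" t] mult_right_mono[OF \<rho>(2), of "(norm (p t))\<^sup>2"] by simp
      moreover have "2 * \<rho>\<^sup>2 * (inner (H t (u t)) (u t) - 2 * D t) \<le> 0"
        using D_lower[of t] by (simp add: mult_nonneg_nonpos)
      ultimately show ?thesis by simp
    qed
    finally show ?thesis by simp
  qed
  note decay = gronwall_exponential_decay[OF deriv this]
  have "(norm (p t))\<^sup>2 + (\<rho>\<^sup>2 - \<gamma> * \<rho> + \<beta>) * (norm (u t))\<^sup>2 \<le> E t" for t
    unfolding E_def using A(3)[of "u t"] mult_left_mono[OF D_upper[of t], of "2 * \<rho>"] \<rho>(1)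
    by (simp add: algebra_simps)
  then have "(norm (v t + \<rho> *\<^sub>R u t))\<^sup>2 + (\<rho>\<^sup>2 - \<gamma> * \<rho> + \<beta>) * (norm (u t))\<^sup>2
      \<le> E 0 * exp (- (2 * \<rho>) * t)" if "t \<ge> 0" for t
    using decay[OF _ that] order_trans unfolding p_def by blast
  then show ?thesis by blast
qed

section \<open>Optimality conditions at a saddle point\<close>

text \<open>Shifting the multiplier by the residual \<open>A \<xi> - b\<close> would raise the
  Lagrangian by the squared norm of that residual, so it vanishes. Since \<open>\<xi>\<close>
  minimises the Lagrangian at \<open>\<eta>\<close>, the derivative in \<open>x\<close> vanishes
  there.\<close>

lemma saddle_point_optimality:
  fixes f :: "'a::{real_inner,complete_space} \<Rightarrow> real" and A :: "'a \<Rightarrow> 'b::real_inner"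
  assumes "(\<xi>, \<eta>) \<in> saddle_points f A b" and A: "bounded_linear A"
    and f: "GDERIV f \<xi> :> grad f \<xi>"
  shows "A \<xi> = b" "grad f \<xi> + adjoint A \<eta> = 0"
proof -
  have sp: "lagrangian f A b \<xi> l \<le> lagrangian f A b \<xi> \<eta>"
     "lagrangian f A b \<xi> \<eta> \<le> lagrangian f A b x \<eta>" for x l
    using assms(1) by (auto simp: saddle_points_def)
  have "inner (A \<xi> - b) (A \<xi> - b) \<le> 0"
    using sp(1)[of "\<eta> + (A \<xi> - b)"] by (simp add: lagrangian_def inner_add_left)
  then have "inner (A \<xi> - b) (A \<xi> - b) = 0" by (intro antisym inner_ge_zero)
  then show "A \<xi> = b" by simp
  have "((\<lambda>x. inner \<eta> (A x - b)) has_derivative (\<lambda>h. inner \<eta> (A h))) (at \<xi>)"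
    by (auto intro!: derivative_eq_intros bounded_linear.has_derivative[OF A])
  then have "((\<lambda>x. lagrangian f A b x \<eta>) has_derivative (\<lambda>h. inner h (grad f \<xi>) + inner \<eta> (A h))) (at \<xi>)"
    unfolding lagrangian_def using f unfolding gderiv_def by (intro has_derivative_add)
  then have "(\<lambda>h. inner h (grad f \<xi>) + inner \<eta> (A h)) = (\<lambda>h. 0)"
    using differential_zero_maxmin[of \<xi> UNIV "\<lambda>x. lagrangian f A b x \<eta>"] sp(2) by simp
  then have "inner h (grad f \<xi> + adjoint A \<eta>) = 0" for h
    by (metis inner_adjoint[OF A] inner_add_right inner_commute)
  then show "grad f \<xi> + adjoint A \<eta> = 0" by (metis inner_eq_zero_iff)
qed

section \<open>Convergence rates for the Arrow-Hurwicz system\<close>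

theorem theorem4p1:
  fixes f :: "'a::{real_inner,complete_space} \<Rightarrow> real"
    and A :: "'a \<Rightarrow> 'b::{real_inner,complete_space}"
    and b :: 'b
    and \<alpha> \<beta> \<gamma> \<rho> :: real
    and x0 :: 'a and l0 :: 'b
    and x :: "real \<Rightarrow> 'a" and l :: "real \<Rightarrow> 'b"
    and \<xi> :: 'a and \<eta> :: 'b
  assumes "convex_on UNIV f"
    and "continuously_differentiable_on UNIV f"
    and "\<And>B. bounded B \<Longrightarrow> \<exists>C. C-lipschitz_on B (grad f)"
    and "bounded_linear A"
    and "saddle_points f A b \<noteq> {}"
    and "continuously_differentiable_on UNIV (grad f)"
    and "\<alpha> > 0" and "\<gamma> > 0"
    and "\<And>u y. \<alpha> * (norm y)\<^sup>2 \<le> inner (hessian f u y) y"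
    and "\<And>u y. inner (hessian f u y) y \<le> \<gamma> * (norm y)\<^sup>2"
    and "\<beta> > 0"
    and "\<And>u. (norm (A u))\<^sup>2 \<ge> \<beta> * (norm u)\<^sup>2"
    and "\<And>u y. 2 * bregman f y u - inner (hessian f u (u - y)) (u - y) \<ge> 0"
    and "\<rho> = (if \<gamma>\<^sup>2 \<le> 4 * \<beta> then \<alpha> / 2
               else min \<alpha> (\<gamma> - sqrt (\<gamma>\<^sup>2 - 4 * \<beta>)) / 2)"
    and "AH_solution f A b x0 l0 x l"
    and "(\<xi>, \<eta>) \<in> saddle_points f A b"
  shows "(\<rho>\<^sup>2 - \<gamma> * \<rho> + \<beta> > 0 \<longrightarrow>
      (\<lambda>t. lagrangian f A b (x t) \<eta> - lagrangian f A b \<xi> (l t))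
        \<in> O[at_top](\<lambda>t. exp (- 2 * \<rho> * t)) \<and>
      (\<lambda>t. (norm (time_deriv x t, time_deriv l t))\<^sup>2)
        \<in> O[at_top](\<lambda>t. exp (- 2 * \<rho> * t)) \<and>
      (\<lambda>t. (norm (x t - \<xi>))\<^sup>2)
        \<in> O[at_top](\<lambda>t. exp (- 2 * \<rho> * t))) \<and>
    (\<rho>\<^sup>2 - \<gamma> * \<rho> + \<beta> = 0 \<longrightarrow>
      (\<lambda>t. lagrangian f A b (x t) \<eta> - lagrangian f A b \<xi> (l t))
        \<in> O[at_top](\<lambda>t. t\<^sup>2 * exp (- 2 * \<rho> * t)) \<and>
      (\<lambda>t. (norm (time_deriv x t, time_deriv l t))\<^sup>2)
        \<in> O[at_top](\<lambda>t. t\<^sup>2 * exp (- 2 * \<rho> * t)) \<and>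
      (\<lambda>t. (norm (x t - \<xi>))\<^sup>2)
        \<in> O[at_top](\<lambda>t. t\<^sup>2 * exp (- 2 * \<rho> * t)))"
proof -
  note f_diff = assms(2) and A = assms(4) and grad_diff = assms(6)
  note pos = assms(7,8,11) and elliptic = assms(9) and hess_bounded = assms(10)
  note A_below = assms(12) and bregman_cond = assms(13) and \<rho>_def = assms(14)
  note sol = assms(15) and saddle = assms(16)
  have f: "GDERIV f u :> grad f u" for u
    using f_diff by (intro GDERIV_grad) (auto simp: continuously_differentiable_on_def)
  have g: "(grad f has_derivative hessian f u) (at u)" for u
    using grad_diff unfolding hessian_def
    by (auto simp: continuously_differentiable_on_def frechet_derivative_works)
  note opt = saddle_point_optimality[OF saddle A f]
  note bregman_ge = bregman_bounds(1)[OF f g elliptic hess_bounded]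
  note bregman_le = bregman_bounds(2)[OF f g elliptic hess_bounded]
  \<comment> \<open>The second entry of the minimum is twice the smaller root of
    \<open>r\<^sup>2 - \<gamma> * r + \<beta>\<close>; it is nonnegative because
    \<open>\<beta> > 0\<close> keeps the square root below \<open>\<gamma>\<close>.\<close>
  have \<rho>: "0 \<le> \<rho>" "2 * \<rho> \<le> \<alpha>"
  proof -
    have "sqrt (\<gamma>\<^sup>2 - 4 * \<beta>) \<le> sqrt (\<gamma>\<^sup>2)" using pos by (intro real_sqrt_le_mono) simp
    then have "sqrt (\<gamma>\<^sup>2 - 4 * \<beta>) \<le> \<gamma>" using pos by simp
    then show "0 \<le> \<rho>" "2 * \<rho> \<le> \<alpha>" using pos by (auto simp: \<rho>_def)
  qed

  \<comment> \<open>The oscillator equation along the trajectory\<close>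
  define u where "u t = x t - \<xi>" for t
  define v where "v t = time_deriv x t" for t
  have xl: "(x has_vector_derivative v t) (at t within {0..})"
    "(l has_vector_derivative time_deriv l t) (at t within {0..})" if "t \<ge> 0" for t
  proof -
    have "(\<lambda>t. (x t, l t)) differentiable (at t within {0..})"
      using sol that by (auto simp: AH_solution_def continuously_differentiable_on_def)
    then obtain D where "((\<lambda>t. (x t, l t)) has_derivative D) (at t within {0..})"
      by (auto simp: differentiable_def)
    from has_derivative_fst[OF this] has_derivative_snd[OF this]
    have "x differentiable (at t within {0..})" "l differentiable (at t within {0..})"
      by (auto simp: differentiable_def)
    then show "(x has_vector_derivative v t) (at t within {0..})"
      "(l has_vector_derivative time_deriv l t) (at t within {0..})"
      unfolding v_def by (simp_all add: vector_derivative_works)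
  qed
  have v_eq: "v t = - grad f (x t) - adjoint A (l t)" if "t \<ge> 0" for t
  proof -
    have "v t + (grad f (x t) + adjoint A (l t)) = 0"
      using sol that unfolding AH_solution_def v_def by (simp add: add.assoc)
    then have "v t = - (grad f (x t) + adjoint A (l t))" by (simp only: eq_neg_iff_add_eq_0)
    then show ?thesis by simp
  qed
  \<comment> \<open>Feasibility \<open>A \<xi> = b\<close> makes the multiplier equation homogeneous
    in \<open>u\<close>.\<close>
  have l_eq: "time_deriv l t = A (u t)" if "t \<ge> 0" for t
  proof -
    have "time_deriv l t + b - A (x t) = 0" using sol that by (simp add: AH_solution_def)
    then show ?thesis
      using opt(1) A by (simp add: u_def linear_diff bounded_linear.linear algebra_simps)
  qed
  have u_deriv: "(u has_vector_derivative v t) (at t within {0..})" if "t \<ge> 0" for t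
    unfolding u_def using xl(1)[OF that] by (auto intro!: derivative_eq_intros)
  have grad_deriv: "((\<lambda>t. grad f (x t)) has_vector_derivative hessian f (x t) (v t)) (at t within {0..})"
    if "t \<ge> 0" for t
  proof -
    have "((\<lambda>t. grad f (x t)) has_derivative (\<lambda>h. hessian f (x t) (h *\<^sub>R v t))) (at t within {0..})"
      using has_derivative_compose[OF xl(1)[OF that, unfolded has_vector_derivative_def] g] .
    then show ?thesis
      by (simp add: has_vector_derivative_def linear_scale[OF has_derivative_linear[OF g]])
  qed
  have v_deriv: "(v has_vector_derivative - hessian f (x t) (v t) - adjoint A (A (u t))) (at t within {0..})"
    if "t \<ge> 0" for t
  \<comment> \<open>The solution is assumed only once differentiable; a second derivative of
    \<open>x\<close> exists because the first equation expresses \<open>v\<close> through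
    \<open>grad f (x t)\<close> and \<open>l t\<close>, which are differentiable.\<close>
  proof -
    have "((\<lambda>t. - grad f (x t) - adjoint A (l t)) has_vector_derivative
        - hessian f (x t) (v t) - adjoint A (A (u t))) (at t within {0..})"
      using xl(2)[OF that] unfolding l_eq[OF that]
      by (intro has_vector_derivative_diff has_vector_derivative_minus grad_deriv that
          bounded_linear.has_vector_derivative[OF bounded_linear_adjoint[OF A]])
    then show ?thesis
      by (rule has_vector_derivative_transform[rotated 2]) (use that v_eq in auto)
  qed
  \<comment> \<open>The base point moves, so the derivative of \<open>f (x t)\<close> cancels
    against that of \<open>\<xi> - x t\<close> and only the Hessian term survives.\<close>
  have bregman_deriv: "((\<lambda>t. bregman f \<xi> (x t)) has_real_derivative inner (hessian f (x t) (v t)) (u t))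
      (at t within {0..})" if "t \<ge> 0" for t
  proof -
    have "((\<lambda>t. f (x t)) has_derivative (\<lambda>h. inner (h *\<^sub>R v t) (grad f (x t)))) (at t within {0..})"
      using has_derivative_compose[OF xl(1)[OF that, unfolded has_vector_derivative_def]
          f[unfolded gderiv_def]] .
    moreover have "((\<lambda>t. inner (grad f (x t)) (\<xi> - x t)) has_derivative
        (\<lambda>h. inner (grad f (x t)) (- (h *\<^sub>R v t)) + inner (h *\<^sub>R hessian f (x t) (v t)) (\<xi> - x t)))
        (at t within {0..})"
      by (rule has_derivative_inner)
        (use xl(1)[OF that] grad_deriv[OF that] in
          \<open>auto simp: has_vector_derivative_def intro!: derivative_eq_intros\<close>)
    ultimately have "((\<lambda>t. f \<xi> - f (x t) - inner (grad f (x t)) (\<xi> - x t)) has_derivative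
        (\<lambda>h. 0 - inner (h *\<^sub>R v t) (grad f (x t)) - (inner (grad f (x t)) (- (h *\<^sub>R v t)) +
          inner (h *\<^sub>R hessian f (x t) (v t)) (\<xi> - x t)))) (at t within {0..})"
      by (intro has_derivative_diff has_derivative_const)
    moreover have "(\<lambda>h. 0 - inner (h *\<^sub>R v t) (grad f (x t)) - (inner (grad f (x t)) (- (h *\<^sub>R v t)) +
          inner (h *\<^sub>R hessian f (x t) (v t)) (\<xi> - x t))) = (*) (inner (hessian f (x t) (v t)) (u t))"
      by (simp add: fun_eq_iff u_def inner_diff_right inner_commute algebra_simps)
    ultimately show ?thesis by (simp add: has_field_derivative_def bregman_def)
  qed
  have "\<exists>C. \<forall>t\<ge>0.
    (norm (v t + \<rho> *\<^sub>R u t))\<^sup>2 + (\<rho>\<^sup>2 - \<gamma> * \<rho> + \<beta>) * (norm (u t))\<^sup>2 \<le> C * exp (- (2 * \<rho>) * t)"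
  proof (rule damped_oscillator_decay[OF u_deriv v_deriv bregman_deriv A _ A_below _ _ elliptic _ _ \<rho>])
    show "inner (A y) z = inner y (adjoint A z)" for y z by (rule inner_adjoint[OF A])
    show "linear (hessian f (x t))" for t by (rule has_derivative_linear[OF g])
    show "inner (hessian f (x t) y) z = inner (hessian f (x t) z) y" for t y z
      by (rule gradient_derivative_symmetric[OF f g])
    \<comment> \<open>The comparison of the Bregman distance with the Hessian form enters here, with
      base point \<open>x t\<close> and target \<open>\<xi>\<close>.\<close>
    show "inner (hessian f (x t) (u t)) (u t) \<le> 2 * bregman f \<xi> (x t)" for t
      using bregman_cond[of \<xi> "x t"] by (simp add: u_def)
    show "bregman f \<xi> (x t) \<le> \<gamma> / 2 * (norm (u t))\<^sup>2" for t
      using bregman_le[of \<xi> "x t"] by (simp add: u_def norm_minus_commute)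
  qed
  then obtain C where C: "\<And>t. t \<ge> 0 \<Longrightarrow>
    (norm (v t + \<rho> *\<^sub>R u t))\<^sup>2 + (\<rho>\<^sup>2 - \<gamma> * \<rho> + \<beta>) * (norm (u t))\<^sup>2 \<le> C * exp (- (2 * \<rho>) * t)"
    by blast

  \<comment> \<open>From bounds on the state to the three rates\<close>
  \<comment> \<open>\<open>\<psi>\<close> is later the pure exponential or \<open>t\<^sup>2\<close>
    times it. The bounds start at \<open>t = 1\<close> because the second choice vanishes at
    0.\<close>
  have rates: "(\<lambda>t. lagrangian f A b (x t) \<eta> - lagrangian f A b \<xi> (l t)) \<in> O[at_top](\<psi>) \<and>
      (\<lambda>t. (norm (time_deriv x t, time_deriv l t))\<^sup>2) \<in> O[at_top](\<psi>) \<and>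
      (\<lambda>t. (norm (x t - \<xi>))\<^sup>2) \<in> O[at_top](\<psi>)"
    if K: "\<And>t. t \<ge> 1 \<Longrightarrow> (norm (u t))\<^sup>2 \<le> K * \<psi> t" "\<And>t. t \<ge> 1 \<Longrightarrow> (norm (v t + \<rho> *\<^sub>R u t))\<^sup>2 \<le> K * \<psi> t"
      and \<psi>: "\<And>t. \<psi> t \<ge> 0"
    for K and \<psi> :: "real \<Rightarrow> real"
  proof -
    have u_rate: "(\<lambda>t. (norm (u t))\<^sup>2) \<in> O[at_top](\<psi>)"
      using K(1) \<psi> by (intro bigoI[of _ K] eventually_at_top_linorderI[of 1]) simp
    have p_rate: "(\<lambda>t. (norm (v t + \<rho> *\<^sub>R u t))\<^sup>2) \<in> O[at_top](\<psi>)"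
      using K(2) \<psi> by (intro bigoI[of _ K] eventually_at_top_linorderI[of 1]) simp
    \<comment> \<open>Feasibility reduces the Lagrangian at \<open>\<xi>\<close> to
      \<open>f \<xi>\<close>, and stationarity trades the multiplier term for
      \<open>grad f \<xi>\<close>. The base point is now \<open>\<xi>\<close>, opposite to the
      distance in the energy.\<close>
    have "lagrangian f A b (x t) \<eta> - lagrangian f A b \<xi> (l t) = bregman f (x t) \<xi>" for t
    proof -
      have "inner (grad f \<xi>) (x t - \<xi>) = - inner (adjoint A \<eta>) (x t - \<xi>)"
        using opt(2) by (simp add: add_eq_0_iff2)
      also have "\<dots> = - inner \<eta> (A (x t) - b)"
        using inner_adjoint[OF A, of "x t - \<xi>" \<eta>] opt(1) A
        by (simp add: inner_commute linear_diff bounded_linear.linear)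
      finally show ?thesis using opt(1) by (simp add: lagrangian_def bregman_def)
    qed
    moreover have "(\<lambda>t. bregman f (x t) \<xi>) \<in> O[at_top](\<lambda>t. (norm (u t))\<^sup>2)"
    proof (intro bigoI[of _ "\<gamma> / 2"] always_eventually allI)
      fix t
      have "0 \<le> bregman f (x t) \<xi>"
        using bregman_ge[of "x t" \<xi>] pos by (meson dual_order.trans mult_nonneg_nonneg
          half_gt_zero less_imp_le zero_le_power2)
      then show "norm (bregman f (x t) \<xi>) \<le> \<gamma> / 2 * norm ((norm (u t))\<^sup>2)"
        using bregman_le[of "x t" \<xi>] by (simp add: u_def)
    qed
    ultimately have L: "(\<lambda>t. lagrangian f A b (x t) \<eta> - lagrangian f A b \<xi> (l t)) \<in> O[at_top](\<psi>)"
      using u_rate landau_o.big_trans by force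
    obtain M where M: "M \<ge> 0" "\<And>y. norm (A y) \<le> norm y * M"
      using A bounded_linear.nonneg_bounded by blast
    \<comment> \<open>The velocity of \<open>x\<close> is recovered by removing
      \<open>\<rho> *\<^sub>R u t\<close> from the controlled sum, and that of \<open>l\<close> is
      \<open>A (u t)\<close>, controlled by the bound \<open>M\<close> of \<open>A\<close>.\<close>
    have "(\<lambda>t. (norm (time_deriv x t, time_deriv l t))\<^sup>2) \<in>
        O[at_top](\<lambda>t. 2 * (norm (v t + \<rho> *\<^sub>R u t))\<^sup>2 + (2 * \<rho>\<^sup>2 + M\<^sup>2) * (norm (u t))\<^sup>2)"
    proof (intro bigoI[of _ 1] eventually_at_top_linorderI[of 0])
      fix t :: real assume t: "t \<ge> 0"
      have "norm (v t) \<le> norm (v t + \<rho> *\<^sub>R u t) + \<rho> * norm (u t)"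
        using norm_triangle_ineq4[of "v t + \<rho> *\<^sub>R u t" "\<rho> *\<^sub>R u t"] \<rho> by simp
      then have "(norm (v t))\<^sup>2 \<le> (norm (v t + \<rho> *\<^sub>R u t) + \<rho> * norm (u t))\<^sup>2"
        by (intro power_mono) auto
      also have "\<dots> \<le> 2 * (norm (v t + \<rho> *\<^sub>R u t))\<^sup>2 + 2 * (\<rho> * norm (u t))\<^sup>2"
        using sum_squares_bound[of "norm (v t + \<rho> *\<^sub>R u t)" "\<rho> * norm (u t)"]
        by (simp add: power2_sum)
      finally have "(norm (v t))\<^sup>2 \<le> 2 * (norm (v t + \<rho> *\<^sub>R u t))\<^sup>2 + 2 * \<rho>\<^sup>2 * (norm (u t))\<^sup>2"
        by (simp add: power_mult_distrib)
      moreover have "(norm (A (u t)))\<^sup>2 \<le> (norm (u t) * M)\<^sup>2" by (intro power_mono M) simp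
      moreover have "(norm (time_deriv x t, time_deriv l t))\<^sup>2 = (norm (v t))\<^sup>2 + (norm (A (u t)))\<^sup>2"
        by (simp add: norm_Pair v_def l_eq[OF t])
      ultimately show "norm ((norm (time_deriv x t, time_deriv l t))\<^sup>2) \<le>
          1 * norm (2 * (norm (v t + \<rho> *\<^sub>R u t))\<^sup>2 + (2 * \<rho>\<^sup>2 + M\<^sup>2) * (norm (u t))\<^sup>2)"
        by (simp add: algebra_simps power_mult_distrib)
    qed
    moreover have "(\<lambda>t. 2 * (norm (v t + \<rho> *\<^sub>R u t))\<^sup>2 + (2 * \<rho>\<^sup>2 + M\<^sup>2) * (norm (u t))\<^sup>2) \<in> O[at_top](\<psi>)"
      using u_rate p_rate by (intro sum_in_bigo) simp_all
    ultimately have "(\<lambda>t. (norm (time_deriv x t, time_deriv l t))\<^sup>2) \<in> O[at_top](\<psi>)"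
      by (rule landau_o.big_trans)
    with L u_rate show ?thesis by (simp add: u_def)
  qed

  \<comment> \<open>The regimes of positive and of vanishing coefficient\<close>
  define \<kappa> where "\<kappa> = \<rho>\<^sup>2 - \<gamma> * \<rho> + \<beta>"
  have positive_case: ?thesis if "\<kappa> > 0"
  proof -
    \<comment> \<open>Dropping one of the two nonnegative summands gives \<open>C\<close> for the
      sum \<open>v t + \<rho> *\<^sub>R u t\<close> and \<open>C / \<kappa>\<close> for
      \<open>u t\<close>; \<open>rates\<close> asks for a common constant.\<close>
    let ?K = "max C (C / \<kappa>)"
    have K: "(norm (u t))\<^sup>2 \<le> ?K * exp (- 2 * \<rho> * t)" "(norm (v t + \<rho> *\<^sub>R u t))\<^sup>2 \<le> ?K * exp (- 2 * \<rho> * t)"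
      if "t \<ge> 1" for t
    proof -
      have *: "(norm (v t + \<rho> *\<^sub>R u t))\<^sup>2 + \<kappa> * (norm (u t))\<^sup>2 \<le> C * exp (- 2 * \<rho> * t)"
        using C[of t] that unfolding \<kappa>_def by simp
      moreover have "\<kappa> * (norm (u t))\<^sup>2 \<ge> 0" using \<open>\<kappa> > 0\<close> by simp
      ultimately have "(norm (v t + \<rho> *\<^sub>R u t))\<^sup>2 \<le> C * exp (- 2 * \<rho> * t)" by linarith
      also have "\<dots> \<le> ?K * exp (- 2 * \<rho> * t)" by (intro mult_right_mono) auto
      finally show "(norm (v t + \<rho> *\<^sub>R u t))\<^sup>2 \<le> ?K * exp (- 2 * \<rho> * t)" .
      have "\<kappa> * (norm (u t))\<^sup>2 \<le> C * exp (- 2 * \<rho> * t)"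
        using * zero_le_power2[of "norm (v t + \<rho> *\<^sub>R u t)"] by linarith
      then have "(norm (u t))\<^sup>2 \<le> C / \<kappa> * exp (- 2 * \<rho> * t)"
        using \<open>\<kappa> > 0\<close> by (simp add: field_simps)
      also have "\<dots> \<le> ?K * exp (- 2 * \<rho> * t)" by (intro mult_right_mono) auto
      finally show "(norm (u t))\<^sup>2 \<le> ?K * exp (- 2 * \<rho> * t)" .
    qed
    show ?thesis using rates[OF K] that by (simp add: \<kappa>_def)
  qed
  have zero_case: ?thesis if "\<kappa> = 0"
  proof -
    have p_le: "(norm (v t + \<rho> *\<^sub>R u t))\<^sup>2 \<le> C * exp (- 2 * \<rho> * t)" if "t \<ge> 0" for t
      using C[OF that] \<open>\<kappa> = 0\<close> unfolding \<kappa>_def by simp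
    \<comment> \<open>Evaluating at \<open>t = 0\<close> shows that \<open>C\<close> dominates a
      square, which makes \<open>sqrt C\<close> usable as a bound on the norm.\<close>
    have C0: "C \<ge> 0" using order_trans[OF _ p_le[of 0], of 0] by simp
    have exp2: "exp (- 2 * \<rho> * t) = (exp (- \<rho> * t))\<^sup>2" for t
      by (simp add: exp_double[symmetric])
    have p_norm: "norm (v t + \<rho> *\<^sub>R u t) \<le> sqrt C * exp (- \<rho> * t)" if "t \<ge> 0" for t
    proof (rule power2_le_imp_le)
      show "(norm (v t + \<rho> *\<^sub>R u t))\<^sup>2 \<le> (sqrt C * exp (- \<rho> * t))\<^sup>2"
        using p_le[OF that] C0 unfolding exp2 by (simp add: power_mult_distrib)
    qed (use C0 in simp)
    \<comment> \<open>For \<open>t \<ge> 1\<close> the affine bound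
      \<open>norm (u 0) + sqrt C * t\<close> is at most \<open>(norm (u 0) + sqrt C) * t\<close>,
      and the same multiple of \<open>t\<close> dominates \<open>sqrt C\<close>.\<close>
    let ?K = "(norm (u 0) + sqrt C)\<^sup>2"
    have K: "(norm (u t))\<^sup>2 \<le> ?K * (t\<^sup>2 * exp (- 2 * \<rho> * t))"
      "(norm (v t + \<rho> *\<^sub>R u t))\<^sup>2 \<le> ?K * (t\<^sup>2 * exp (- 2 * \<rho> * t))" if "t \<ge> 1" for t
    proof -
      have "norm (u 0) \<le> norm (u 0) * t" using that by (simp add: mult_le_cancel_left1)
      then have 1: "norm (u 0) + sqrt C * t \<le> (norm (u 0) + sqrt C) * t"
        by (simp add: distrib_right)
      have "norm (u t) \<le> (norm (u 0) + sqrt C * t) * exp (- \<rho> * t)"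
        by (rule linear_growth_exponential_decay[OF u_deriv p_norm]) (use that in auto)
      also have "\<dots> \<le> (norm (u 0) + sqrt C) * t * exp (- \<rho> * t)"
        by (intro mult_right_mono 1) simp
      finally have "(norm (u t))\<^sup>2 \<le> ((norm (u 0) + sqrt C) * t * exp (- \<rho> * t))\<^sup>2"
        by (intro power_mono) auto
      then show "(norm (u t))\<^sup>2 \<le> ?K * (t\<^sup>2 * exp (- 2 * \<rho> * t))"
        unfolding exp2 by (simp only: power_mult_distrib mult.assoc)
      have "sqrt C \<le> sqrt C * t" using that C0 by (simp add: mult_le_cancel_left1)
      then have 2: "sqrt C \<le> (norm (u 0) + sqrt C) * t" using 1 norm_ge_zero[of "u 0"] by linarith
      have "norm (v t + \<rho> *\<^sub>R u t) \<le> sqrt C * exp (- \<rho> * t)" using that by (intro p_norm) simp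
      also have "\<dots> \<le> (norm (u 0) + sqrt C) * t * exp (- \<rho> * t)"
        by (intro mult_right_mono 2) simp
      finally have "(norm (v t + \<rho> *\<^sub>R u t))\<^sup>2 \<le> ((norm (u 0) + sqrt C) * t * exp (- \<rho> * t))\<^sup>2"
        by (intro power_mono) auto
      then show "(norm (v t + \<rho> *\<^sub>R u t))\<^sup>2 \<le> ?K * (t\<^sup>2 * exp (- 2 * \<rho> * t))"
        unfolding exp2 by (simp only: power_mult_distrib mult.assoc)
    qed
    show ?thesis using rates[OF K] that by (simp add: \<kappa>_def)
  qed
  show ?thesis using positive_case zero_case unfolding \<kappa>_def by blast
qed

end
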